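(* Let $G=J_2(4,2)$. Then $G$ is not a core. Moreover, $\chi(G)=\omega(G)=7$ and $\alpha(G)=5$.
   Context: The Grassmann graph $J_2(4,2)$ is the simple undirected graph whose vertices are the $2$-dimensional subspaces of a $4$-dimensional vector space over the field $\mathbb{F}_2$ with two elements, two vertices $X,Y$ being adjacent iff $\dim(X\cap Y)=1$. An endomorphism of a graph $G$ is a map $\varphi:V(G)\to V(G)$ such that $\varphi(x)\sim\varphi(y)$ whenever $x\sim y$. A graph is a core if every endomorphism of it is an automorphism. $\chi(G)$ is the chromatic number, $\omega(G)$ the clique number (number of vertices in a maximum clique), and $\alpha(G)$ the independence number (size of a largest independent set). *)

theory Defs
  imports "HOL-Library.Z2" "HOL-Library.FuncSet" "Graph_Theory.Pair_Digraph"
begin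

text \<open>
  A simple undirected graph is a \<^typ>\<open>'a pair_pre_digraph\<close> whose arc relation is symmetric
  and irreflexive; an edge \<open>xy\<close> is represented by the two arcs \<open>(x, y)\<close> and \<open>(y, x)\<close>.
\<close>

definition graph_endomorphism :: "'a pair_pre_digraph \<Rightarrow> ('a \<Rightarrow> 'a) \<Rightarrow> bool" where
  "graph_endomorphism G \<phi> \<longleftrightarrow>
     \<phi> \<in> pverts G \<rightarrow> pverts G \<and>
     (\<forall>x\<in>pverts G. \<forall>y\<in>pverts G. (x, y) \<in> parcs G \<longrightarrow> (\<phi> x, \<phi> y) \<in> parcs G)"

definition graph_automorphism :: "'a pair_pre_digraph \<Rightarrow> ('a \<Rightarrow> 'a) \<Rightarrow> bool" where
  "graph_automorphism G \<phi> \<longleftrightarrow>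
     bij_betw \<phi> (pverts G) (pverts G) \<and>
     (\<forall>x\<in>pverts G. \<forall>y\<in>pverts G. (x, y) \<in> parcs G \<longleftrightarrow> (\<phi> x, \<phi> y) \<in> parcs G)"

definition core_graph :: "'a pair_pre_digraph \<Rightarrow> bool" where
  "core_graph G \<longleftrightarrow> (\<forall>\<phi>. graph_endomorphism G \<phi> \<longrightarrow> graph_automorphism G \<phi>)"

definition proper_colouring :: "'a pair_pre_digraph \<Rightarrow> nat \<Rightarrow> ('a \<Rightarrow> nat) \<Rightarrow> bool" where
  "proper_colouring G k c \<longleftrightarrow>
     c \<in> pverts G \<rightarrow> {..<k} \<and>
     (\<forall>x\<in>pverts G. \<forall>y\<in>pverts G. (x, y) \<in> parcs G \<longrightarrow> c x \<noteq> c y)"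

definition clique_set :: "'a pair_pre_digraph \<Rightarrow> 'a set \<Rightarrow> bool" where
  "clique_set G C \<longleftrightarrow>
     C \<subseteq> pverts G \<and> (\<forall>x\<in>C. \<forall>y\<in>C. x \<noteq> y \<longrightarrow> (x, y) \<in> parcs G)"

definition independent_set :: "'a pair_pre_digraph \<Rightarrow> 'a set \<Rightarrow> bool" where
  "independent_set G S \<longleftrightarrow>
     S \<subseteq> pverts G \<and> (\<forall>x\<in>S. \<forall>y\<in>S. (x, y) \<notin> parcs G)"

text \<open>The following three invariants are meaningful for finite loopless graphs only.\<close>

definition chromatic_number :: "'a pair_pre_digraph \<Rightarrow> nat" where
  "chromatic_number G = (LEAST k. \<exists>c. proper_colouring G k c)"

definition clique_number :: "'a pair_pre_digraph \<Rightarrow> nat" where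
  "clique_number G = Max {card C | C. clique_set G C}"

definition independence_number :: "'a pair_pre_digraph \<Rightarrow> nat" where
  "independence_number G = Max {card S | S. independent_set G S}"

text \<open>
  The graph on the 2-dimensional subspaces of the vector space with scalar multiplication
  \<open>scale\<close>; for a 4-dimensional space over \<^typ>\<open>bit\<close> this is $J_2(4,2)$.
\<close>

definition grassmann_graph_2 ::
  "('k::field \<Rightarrow> 'v::ab_group_add \<Rightarrow> 'v) \<Rightarrow> 'v set pair_pre_digraph" where
  "grassmann_graph_2 scale =
     (let V = {X. module.subspace scale X \<and> vector_space.dim scale X = 2}
      in \<lparr> pverts = V,
           parcs = {(X, Y). X \<in> V \<and> Y \<in> V \<and> vector_space.dim scale (X \<inter> Y) = 1} \<rparr>)"

lemma grassmann_graph_2_simple: "pair_bidirected_digraph (grassmann_graph_2 scale)"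
  by unfold_locales
    (auto simp: grassmann_graph_2_def symmetric_def Int_commute intro!: symI)

end

theory Submission
  imports Defs
begin

text \<open>
  The vertices are the lines of $PG(3,2)$, adjacent iff they meet in one point. Independent sets
  are partial spreads, and since a line covers 3 of the 15 points they have at most 5 elements.
  The lines admit a packing, i.e. a partition into 7 spreads (a solution of Kirkman's
  schoolgirl problem), which is a proper 7-colouring. The 7 lines through a point form a clique,
  so clique and chromatic number are both 7, and colouring followed by a bijection onto this
  clique is an endomorphism that is not an automorphism.
\<close>

section \<open>Colourings and cliques\<close>

lemma proper_colouring_inj_on_clique:
  assumes "proper_colouring G k c" and "clique_set G C"
  shows "inj_on c C"
  using assms unfolding proper_colouring_def clique_set_def inj_on_def by blast

lemma card_clique_le_colours:
  assumes "proper_colouring G k c" and "clique_set G C"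
  shows "card C \<le> k"
proof -
  have "c ` C \<subseteq> {..<k}"
    using assms by (auto simp: proper_colouring_def clique_set_def)
  then show ?thesis
    using card_inj_on_le[OF proper_colouring_inj_on_clique[OF assms], of "{..<k}"] by simp
qed

text \<open>The vertices of a clique need pairwise different colours, so \<open>card C\<close> is a
  lower bound for every proper colouring; \<open>c\<close> attains it.\<close>

lemma chromatic_number_eq_card_clique:
  assumes "proper_colouring G (card C) c" and "clique_set G C"
  shows "chromatic_number G = card C"
  unfolding chromatic_number_def
proof (rule Least_equality)
  show "\<exists>c. proper_colouring G (card C) c"
    using assms(1) by auto
  show "card C \<le> k" if "\<exists>c. proper_colouring G k c" for k
    using that card_clique_le_colours[OF _ assms(2)] by auto
qed

text \<open>The same bound read the other way: \<open>c\<close> limits the size of every clique, and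
  \<open>C\<close> attains the limit. The bound also makes the set of sizes finite, as
  \<open>Max\<close> requires.\<close>

lemma clique_number_eq_colours:
  assumes "proper_colouring G (card C) c" and "clique_set G C"
  shows "clique_number G = card C"
  unfolding clique_number_def
proof (rule Max_eqI)
  have "{card C' | C'. clique_set G C'} \<subseteq> {..card C}"
    using card_clique_le_colours[OF assms(1)] by auto
  then show "finite {card C' | C'. clique_set G C'}"
    by (rule finite_subset) simp
qed (use assms card_clique_le_colours[OF assms(1)] in auto)

text \<open>Using the vertices of \<open>C\<close> themselves as colours turns the colouring into an
  endomorphism with image inside \<open>C\<close>. An automorphism is onto, so it would force every
  vertex into the clique \<open>C\<close>.\<close>

lemma not_core_graph_if_colouring_by_clique:
  assumes c: "proper_colouring G (card C) c" and C: "clique_set G C" "finite C"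
    and "\<not> clique_set G (pverts G)"
  shows "\<not> core_graph G"
proof
  assume core: "core_graph G"
  obtain f where f: "bij_betw f {..<card C} C"
    using ex_bij_betw_nat_finite[OF C(2)] by (auto simp: atLeast0LessThan)
  have c_less: "c x \<in> {..<card C}" if "x \<in> pverts G" for x
    using c that by (auto simp: proper_colouring_def)
  have fc: "f (c x) \<in> C" if "x \<in> pverts G" for x
    using f c_less[OF that] by (auto simp: bij_betw_def)
  have "graph_endomorphism G (f \<circ> c)"
    unfolding graph_endomorphism_def
  proof (intro conjI ballI impI)
    show "f \<circ> c \<in> pverts G \<rightarrow> pverts G"
      using fc C(1) by (auto simp: clique_set_def)
  next
    fix x y assume xy: "x \<in> pverts G" "y \<in> pverts G" "(x, y) \<in> parcs G"
    then have "c x \<noteq> c y"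
      using c by (auto simp: proper_colouring_def)
    then have "f (c x) \<noteq> f (c y)"
      using f c_less xy(1,2) by (auto simp: bij_betw_def inj_on_def)
    then show "((f \<circ> c) x, (f \<circ> c) y) \<in> parcs G"
      using C(1) fc xy(1,2) by (auto simp: clique_set_def)
  qed
  then have "graph_automorphism G (f \<circ> c)"
    using core by (simp add: core_graph_def)
  then have "(f \<circ> c) ` pverts G = pverts G"
    by (simp add: graph_automorphism_def bij_betw_def)
  moreover have "(f \<circ> c) ` pverts G \<subseteq> C"
    using fc by auto
  ultimately have "pverts G \<subseteq> C"
    by simp
  then have "clique_set G (pverts G)"
    using C(1) by (auto simp: clique_set_def)
  with assms(4) show False by contradiction
qed

text \<open>The numbers fixed by \<open>take_bit d\<close> are those below \<open>2 ^ d\<close>, and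
  \<open>take_bit\<close> commutes with XOR.\<close>

lemma xor_nat_less_power: "m < 2 ^ d \<Longrightarrow> n < 2 ^ d \<Longrightarrow> xor m n < 2 ^ d" for m n :: nat
  by (metis take_bit_nat_eq_self_iff take_bit_xor)

section \<open>Vector spaces over the field with two elements\<close>

locale binary_vector_space = vector_space scale
  for scale :: "bit \<Rightarrow> 'v::ab_group_add \<Rightarrow> 'v"
begin

lemma scale_bit: "scale k x = (if k = 0 then 0 else x)"
  by (cases k) simp_all

lemma add_self [simp]: "x + x = (0::'v)"
  using scale_left_distrib[of 1 1 x] by simp

lemma add_self_left [simp]: "x + (x + y) = (y::'v)"
  by (simp flip: add.assoc)

lemma add_eq_0_iff_eq [simp]: "x + y = 0 \<longleftrightarrow> x = (y::'v)"
  by (metis add_self add_self_left add_0_right)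

text \<open>The only scalars are 0 and 1, so closure under scaling comes for free.\<close>

lemma subspace_bitI: "0 \<in> S \<Longrightarrow> (\<And>x y. x \<in> S \<Longrightarrow> y \<in> S \<Longrightarrow> x + y \<in> S) \<Longrightarrow> subspace S"
  by (auto simp: subspace_def scale_bit)

lemma span_singleton_bit: "span {x} = {0, x}"
proof
  show "span {x} \<subseteq> {0, x}"
    by (intro span_minimal subspace_bitI) auto
  show "{0, x} \<subseteq> span {x}"
    by (simp add: span_zero span_base)
qed

section \<open>Projective lines as two-dimensional subspaces\<close>

definition line :: "'v \<Rightarrow> 'v \<Rightarrow> 'v set" where
  "line a b = {0, a, b, a + b}"

lemma span_pair_bit: "span {a, b} = line a b"
proof
  have "subspace (line a b)"
    by (rule subspace_bitI) (auto simp: line_def ac_simps)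
  then show "span {a, b} \<subseteq> line a b"
    by (intro span_minimal) (auto simp: line_def)
  show "line a b \<subseteq> span {a, b}"
    by (auto simp: line_def intro: span_base span_add span_zero)
qed

definition lines :: "'v set set" where
  "lines = {X. subspace X \<and> dim X = 2}"

lemma independent_pair_bit: "independent {a, b} \<longleftrightarrow> a \<noteq> 0 \<and> b \<noteq> 0" if "a \<noteq> b"
  using that by (auto simp: independent_insert span_singleton_bit)

lemma lines_eq: "lines = {line a b | a b. a \<noteq> 0 \<and> b \<noteq> 0 \<and> a \<noteq> b}"
proof (intro subset_antisym subsetI)
  fix X assume "X \<in> lines"
  then have X: "subspace X" "dim X = 2"
    by (auto simp: lines_def)
  obtain B where B: "B \<subseteq> X" "independent B" "X \<subseteq> span B" "card B = dim X"
    using basis_exists[of X] by blast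
  obtain a b where ab: "B = {a, b}" "a \<noteq> b"
    using B(4) X(2) by (auto simp: card_2_iff)
  have "X = line a b"
    using B X(1) ab span_subspace span_pair_bit by metis
  then show "X \<in> {line a b | a b. a \<noteq> 0 \<and> b \<noteq> 0 \<and> a \<noteq> b}"
    using B(2) ab independent_pair_bit by blast
next
  fix X assume "X \<in> {line a b | a b. a \<noteq> 0 \<and> b \<noteq> 0 \<and> a \<noteq> b}"
  then obtain a b where ab: "X = line a b" "a \<noteq> 0" "b \<noteq> 0" "a \<noteq> b"
    by auto
  then have "independent {a, b}"
    using independent_pair_bit by simp
  then have "dim X = 2"
    using ab dim_span_eq_card_independent[of "{a, b}"] by (simp add: span_pair_bit)
  moreover have "subspace X"
    unfolding ab(1) span_pair_bit[symmetric] by (rule subspace_span)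
  ultimately show "X \<in> lines"
    by (simp add: lines_def)
qed

text \<open>Over two elements a one-dimensional subspace has a single nonzero vector, so nonzero
  vectors serve as projective points, and this counts the points on a line.\<close>

lemma card_line_Diff_0:
  assumes "X \<in> lines"
  shows "card (X - {0}) = 3"
proof -
  obtain a b where ab: "X = line a b" "a \<noteq> 0" "b \<noteq> 0" "a \<noteq> b"
    using assms by (auto simp: lines_eq)
  moreover have "a + b \<noteq> a" "a + b \<noteq> b"
    using ab by simp_all
  ultimately have "X - {0} = {a, b, a + b}"
    by (auto simp: line_def)
  then show ?thesis
    using ab \<open>a + b \<noteq> a\<close> \<open>a + b \<noteq> b\<close> by (auto simp: card_insert_if)
qed

text \<open>Two points determine a line: of the three nonzero vectors \<open>a\<close>,
  \<open>b\<close>, \<open>a + b\<close>, any two sum to the third.\<close>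

lemma line_determined:
  assumes "X \<in> lines" and "x \<in> X" "y \<in> X" "x \<noteq> 0" "y \<noteq> 0" "x \<noteq> y"
  shows "X = line x y"
proof -
  obtain a b where "X = line a b"
    using assms(1) by (auto simp: lines_eq)
  then show ?thesis
    using assms(2-) unfolding line_def by (auto simp: ac_simps)
qed

text \<open>Two common points would determine both lines and make them equal. Hence distinct lines
  meet in \<open>{0}\<close> or in some \<open>{0, x}\<close>, which is the span of
  \<open>x\<close>.\<close>

lemma dim_line_Int_eq_1_iff:
  assumes X: "X \<in> lines" and Y: "Y \<in> lines"
  shows "dim (X \<inter> Y) = 1 \<longleftrightarrow> X \<noteq> Y \<and> X \<inter> Y \<noteq> {0}"
proof (cases "X \<noteq> Y \<and> X \<inter> Y \<noteq> {0}")
  case True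
  have "0 \<in> X \<inter> Y"
    using X Y by (auto simp: lines_def subspace_0)
  then obtain x where x: "x \<in> X" "x \<in> Y" "x \<noteq> 0"
    using True by auto
  have "y = 0 \<or> y = x" if "y \<in> X \<inter> Y" for y
    using that True x line_determined[OF X, of x y] line_determined[OF Y, of x y] by auto
  then have "X \<inter> Y = span {x}"
    using x \<open>0 \<in> X \<inter> Y\<close> by (auto simp: span_singleton_bit)
  moreover have "independent {x}"
    using x by (simp add: independent_insert)
  ultimately show ?thesis
    using True dim_span_eq_card_independent[of "{x}"] by simp
next
  case False
  have "dim {0} = 0"
    using dim_eq_card[of "{}" "{0}"] independent_empty by simp
  then show ?thesis
    using False X by (auto simp: lines_def)
qed

section \<open>The Grassmann graph in terms of lines, and coordinates on the space\<close>

lemma pverts_grassmann_bit: "pverts (grassmann_graph_2 scale) = lines"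
  by (simp add: grassmann_graph_2_def lines_def)

lemma parcs_grassmann_bit:
  "parcs (grassmann_graph_2 scale) = {(X, Y). X \<in> lines \<and> Y \<in> lines \<and> X \<noteq> Y \<and> X \<inter> Y \<noteq> {0}}"
  using dim_line_Int_eq_1_iff
  by (auto simp: grassmann_graph_2_def Let_def simp flip: lines_def simp del: One_nat_def)

text \<open>Non-adjacent distinct lines share only 0, so the members of \<open>S\<close> occupy
  disjoint triples of nonzero vectors.\<close>

lemma card_independent_set_le:
  assumes "finite (UNIV :: 'v set)" and S: "independent_set (grassmann_graph_2 scale) S"
  shows "3 * card S \<le> card (UNIV :: 'v set) - 1"
proof -
  have fin: "finite A" for A :: "'v set"
    using assms(1) by (rule rev_finite_subset) simp
  have "finite S"
    by (rule finite_subset[OF _ finite_Pow_iff[THEN iffD2, OF assms(1)]]) auto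
  have S_lines: "X \<in> lines" if "X \<in> S" for X
    using S that by (auto simp: independent_set_def pverts_grassmann_bit)
  have disj: "(X - {0}) \<inter> (Y - {0}) = {}" if "X \<in> S" "Y \<in> S" "X \<noteq> Y" for X Y
  proof -
    have "(X, Y) \<notin> parcs (grassmann_graph_2 scale)"
      using S that by (simp add: independent_set_def)
    then have "X \<inter> Y = {0}"
      using that S_lines by (simp add: parcs_grassmann_bit)
    then show ?thesis by auto
  qed
  have "card (\<Union>X\<in>S. X - {0}) = (\<Sum>X\<in>S. card (X - {0}))"
    by (rule card_UN_disjoint) (use \<open>finite S\<close> fin disj in blast)+
  also have "\<dots> = 3 * card S"
    using S_lines by (simp add: card_line_Diff_0)
  finally have "3 * card S = card (\<Union>X\<in>S. X - {0})" ..
  also have "\<dots> \<le> card (UNIV - {0 :: 'v})"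
    by (intro card_mono fin) auto
  finally show ?thesis
    by (simp add: card_Diff_singleton)
qed

text \<open>A basis turns vectors into bit strings, i.e. numbers below $2^d$ with XOR as addition.\<close>

lemma xor_coordinates_exist:
  assumes "dim (UNIV :: 'v set) = d" and "d > 0"
  obtains p :: "nat \<Rightarrow> 'v" where "bij_betw p {..<2 ^ d} UNIV"
    and "\<And>m n. p (xor m n) = p m + p n"
proof -
  obtain B :: "'v set" where B: "independent B" "UNIV \<subseteq> span B" "card B = d"
    using basis_exists[of UNIV] assms(1) by metis
  then have "finite B"
    using assms(2) card_gt_0_iff by blast
  then obtain e where e: "bij_betw e {..<d} B"
    using ex_bij_betw_nat_finite[of B] B(3) by (auto simp: atLeast0LessThan)
  \<comment> \<open>Bit \<open>i\<close> of \<open>n\<close> is the coefficient of the basis vector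
    \<open>e i\<close>. XOR adds bits without carry, exactly as addition in \<open>bit\<close>
    does.\<close>
  define p where "p n = (\<Sum>i<d. scale (of_bool (bit n i)) (e i))" for n :: nat
  have p_xor: "p (xor m n) = p m + p n" for m n
    unfolding p_def sum.distrib[symmetric]
    by (intro sum.cong) (auto simp: bit_xor_iff)
  have p_0: "p 0 = 0"
    by (simp add: p_def)
  \<comment> \<open>\<open>p\<close> ignores the bits from position \<open>d\<close> on, so its
    kernel is trivial only among numbers below \<open>2 ^ d\<close>.\<close>
  have ker: "n = 0" if "p n = 0" "n < 2 ^ d" for n
  proof -
    \<comment> \<open>The coefficients are re-indexed by basis vectors to match the form in which
      linear independence is applied.\<close>
    define u where "u b = (of_bool (bit n (inv_into {..<d} e b)) :: bit)" for b
    have "(\<Sum>b\<in>B. scale (u b) b) = (\<Sum>i<d. scale (u (e i)) (e i))"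
      using sum.reindex_bij_betw[OF e, of "\<lambda>b. scale (u b) b"] by simp
    also have "\<dots> = p n"
      unfolding p_def u_def using e by (intro sum.cong) (auto simp: bij_betw_def)
    finally have sum_0: "(\<Sum>b\<in>B. scale (u b) b) = 0"
      using that(1) by simp
    have "\<not> bit n i" if "i < d" for i
    proof -
      have "u (e i) = 0"
        using independentD[OF B(1) \<open>finite B\<close> subset_refl sum_0] that e
        by (auto simp: bij_betw_def)
      then show ?thesis
        using that e by (auto simp: u_def bij_betw_def split: if_splits)
    qed
    then have "take_bit d n = 0"
      by (intro bit_eqI) (auto simp: bit_take_bit_iff)
    then show ?thesis
      using that(2) by (simp add: take_bit_nat_eq_self)
  qed
  have "inj_on p {..<2 ^ d}"
  proof (rule inj_onI)
    fix m n :: nat assume mn: "m \<in> {..<2 ^ d}" "n \<in> {..<2 ^ d}" "p m = p n"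
    then have "p (xor m n) = 0"
      by (simp add: p_xor)
    then have "xor m n = 0"
      using ker xor_nat_less_power mn by simp
    then show "m = n"
      by (metis xor.assoc xor_self_eq xor.left_neutral xor.right_neutral)
  qed
  moreover have "p ` {..<2 ^ d} = UNIV"
  proof -
    \<comment> \<open>Surjectivity: the image is a subspace containing the basis \<open>B\<close>,
      hence contains its span. The vector \<open>e i\<close> is the image of \<open>2 ^ i\<close>,
      whose only set bit is \<open>i\<close>.\<close>
    have "subspace (p ` {..<2 ^ d})"
      by (rule subspace_bitI) (use p_0 xor_nat_less_power p_xor in \<open>force simp flip: p_xor\<close>)+
    moreover have "B \<subseteq> p ` {..<2 ^ d}"
    proof
      fix b assume "b \<in> B"
      then obtain i where i: "i < d" "b = e i"
        using e by (auto simp: bij_betw_def)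
      have "p (2 ^ i) = (\<Sum>j<d. if j = i then e j else 0)"
        unfolding p_def by (intro sum.cong) (auto simp: bit_exp_iff)
      then have "b = p (2 ^ i)"
        using i by simp
      then show "b \<in> p ` {..<2 ^ d}"
        using i(1) by (auto intro!: imageI)
    qed
    ultimately show ?thesis
      using B(2) span_minimal by blast
  qed
  ultimately show ?thesis
    using that p_xor by (auto simp: bij_betw_def)
qed

end

section \<open>A packing of the lines of $PG(3,2)$\<close>

definition xor_line :: "nat \<times> nat \<Rightarrow> nat set" where
  "xor_line = (\<lambda>(a, b). {0, a, b, xor a b})"

text \<open>Each row is a spread, every line being given by two of its points. Found by search.\<close>

definition packing :: "(nat \<times> nat) list list" where
  "packing =
    [[(1,2), (4,8), (5,10), (6,11), (7,9)],
     [(1,4), (2,8), (3,13), (6,9), (7,11)],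
     [(1,6), (2,9), (3,12), (4,10), (5,8)],
     [(1,8), (2,12), (3,5), (4,11), (7,10)],
     [(1,10), (2,13), (3,4), (5,9), (6,8)],
     [(1,12), (2,4), (3,9), (5,11), (7,8)],
     [(1,14), (2,5), (3,8), (4,9), (6,10)]]"

lemma length_packing: "length packing = 7"
  by (simp add: packing_def)

lemma packing_disjoint:
  "\<forall>s\<in>set packing. \<forall>q\<in>set s. \<forall>r\<in>set s. q \<noteq> r \<longrightarrow> xor_line q \<inter> xor_line r = {0}"
  by (simp add: packing_def xor_line_def)

text \<open>Checking pairs of points is enough to reach every line, because two points determine a
  line. The 35 listed lines with 3 pairs each account for all 105 pairs among the 15 points.\<close>

lemma packing_cover:
  "\<forall>a\<in>set [1..<16]. \<forall>b\<in>set [1..<16]. a \<noteq> b \<longrightarrow>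
     (\<exists>s\<in>set packing. \<exists>q\<in>set s. a \<in> xor_line q \<and> b \<in> xor_line q)"
  by (simp add: packing_def xor_line_def upt_rec[of 1] del: set_upt One_nat_def)

lemma packing_nondegenerate:
  "\<forall>s\<in>set packing. \<forall>(a, b)\<in>set s. a \<noteq> 0 \<and> b \<noteq> 0 \<and> a \<noteq> b \<and> a < 16 \<and> b < 16"
  by (simp add: packing_def)

lemma card_packing_hd: "card (xor_line ` set (hd packing)) = 5"
  by code_simp

text \<open>The lines through the point 1. The other points fall into pairs \<open>b\<close>,
  \<open>xor 1 b\<close> that differ in the lowest bit, so the even numbers represent each line
  once.\<close>

definition pencil :: "nat set set" where
  "pencil = (\<lambda>b. xor_line (1, b)) ` set [2, 4, 6, 8, 10, 12, 14]"

lemma card_pencil: "card pencil = 7"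
  by code_simp

section \<open>Transport of the packing into the vector space along \<open>p\<close>\<close>

locale binary_space_4 = binary_vector_space scale
  for scale :: "bit \<Rightarrow> 'v::ab_group_add \<Rightarrow> 'v" +
  fixes p :: "nat \<Rightarrow> 'v"
  assumes bij_p: "bij_betw p {..<16} UNIV" and p_xor: "p (xor m n) = p m + p n"
begin

lemma inj_p: "inj_on p {..<16}"
  using bij_p by (simp add: bij_betw_def)

lemma p_0: "p 0 = 0"
  using p_xor[of 0 0] by simp

lemma p_eq_iff: "m < 16 \<Longrightarrow> n < 16 \<Longrightarrow> p m = p n \<longleftrightarrow> m = n"
  using inj_p by (auto simp: inj_on_def)

lemma p_eq_0_iff: "n < 16 \<Longrightarrow> p n = 0 \<longleftrightarrow> n = 0"
  using p_eq_iff[of n 0] by (simp add: p_0)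

lemma p_surj: obtains n where "n < 16" "p n = v"
proof -
  have "v \<in> p ` {..<16}"
    using bij_p by (simp add: bij_betw_def)
  then show thesis
    using that by auto
qed

lemma finite_card_UNIV: "finite (UNIV :: 'v set)" "card (UNIV :: 'v set) = 16"
  using bij_betw_finite[OF bij_p] bij_betw_same_card[OF bij_p] by simp_all

lemma image_xor_line: "p ` xor_line (a, b) = line (p a) (p b)"
  by (simp add: xor_line_def line_def p_0 p_xor)

lemma xor_line_subset: "a < 16 \<Longrightarrow> b < 16 \<Longrightarrow> xor_line (a, b) \<subseteq> {..<16}"
  using xor_nat_less_power[of a 4 b] by (simp add: xor_line_def)

lemma packing_line_subset: "s \<in> set packing \<Longrightarrow> q \<in> set s \<Longrightarrow> xor_line q \<subseteq> {..<16}"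
  using packing_nondegenerate xor_line_subset by (cases q) fast

lemma image_xor_line_in_lines:
  assumes "a \<noteq> 0" "b \<noteq> 0" "a \<noteq> b" "a < 16" "b < 16"
  shows "p ` xor_line (a, b) \<in> lines"
  unfolding image_xor_line lines_eq using assms p_eq_iff p_eq_0_iff by blast

text \<open>Injectivity of \<open>p\<close> passes to images of subsets, so the sizes of families of
  lines computed on numbers carry over to the vector space.\<close>

lemma card_image_image:
  assumes "\<Union>A \<subseteq> {..<16}"
  shows "card (image p ` A) = card A"
  using inj_on_image[of p A] inj_p assms by (intro card_image) (auto intro: inj_on_subset)

definition spread :: "nat \<Rightarrow> 'v set set" where
  "spread i = image p ` xor_line ` set (packing ! i)"

lemma spread_lines:
  assumes "i < 7"
  shows "spread i \<subseteq> lines"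
proof -
  have "packing ! i \<in> set packing"
    using assms length_packing by simp
  then show ?thesis
    using packing_nondegenerate image_xor_line_in_lines by (fastforce simp: spread_def)
qed

lemma spread_disjoint:
  assumes "i < 7" "X \<in> spread i" "Y \<in> spread i" "X \<noteq> Y"
  shows "X \<inter> Y = {0}"
proof -
  have row: "packing ! i \<in> set packing"
    using assms length_packing by simp
  obtain q r where q: "q \<in> set (packing ! i)" "X = p ` xor_line q"
    and r: "r \<in> set (packing ! i)" "Y = p ` xor_line r"
    using assms(2,3) unfolding spread_def by blast
  have "q \<noteq> r"
    using q r assms(4) by auto
  then have "xor_line q \<inter> xor_line r = {0}"
    using packing_disjoint row q(1) r(1) by simp
  moreover have "xor_line q \<subseteq> {..<16}" "xor_line r \<subseteq> {..<16}"
    using packing_line_subset row q r by simp_all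
  ultimately show ?thesis
    \<comment> \<open>The image of an intersection is the intersection of the images because
      \<open>p\<close> is injective on the 16 numbers.\<close>
    using inj_on_image_Int[OF inj_p, of "xor_line q" "xor_line r"] q r p_0 by simp
qed

text \<open>Two nonzero vectors of \<open>X\<close>, read as numbers, lie on a line of the table;
  its image shares both with \<open>X\<close> and so equals \<open>X\<close>.\<close>

lemma lines_covered_by_spreads:
  assumes "X \<in> lines"
  shows "\<exists>i<7. X \<in> spread i"
proof -
  obtain u v where uv: "X = line u v" "u \<noteq> 0" "v \<noteq> 0" "u \<noteq> v"
    using assms by (auto simp: lines_eq)
  obtain a b where ab: "a < 16" "p a = u" "b < 16" "p b = v"
    using p_surj by metis
  have "a \<noteq> 0" "b \<noteq> 0" "a \<noteq> b"
    using uv ab p_0 by metis+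
  then have "\<exists>s\<in>set packing. \<exists>q\<in>set s. a \<in> xor_line q \<and> b \<in> xor_line q"
    using packing_cover ab by simp
  then obtain i q where i: "i < 7" and q: "q \<in> set (packing ! i)" "a \<in> xor_line q" "b \<in> xor_line q"
    using length_packing by (metis in_set_conv_nth)
  define Y where "Y = p ` xor_line q"
  have Y: "Y \<in> spread i" "u \<in> Y" "v \<in> Y"
    using q ab by (auto simp: Y_def spread_def)
  then have "Y = X"
    using line_determined[of Y u v] spread_lines[OF i] uv by auto
  then show ?thesis
    using i Y(1) by auto
qed

section \<open>The colouring, the clique and the independent sets of the graph\<close>

lemma spread_colouring:
  obtains c where "proper_colouring (grassmann_graph_2 scale) 7 c"
proof -
  obtain c where c: "\<And>X. X \<in> lines \<Longrightarrow> c X < 7" "\<And>X. X \<in> lines \<Longrightarrow> X \<in> spread (c X)"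
    using lines_covered_by_spreads by metis
  \<comment> \<open>Adjacent lines share a nonzero vector, whereas distinct lines of one spread
    share only 0.\<close>
  have "c X \<noteq> c Y" if "X \<in> lines" "Y \<in> lines" "X \<noteq> Y" "X \<inter> Y \<noteq> {0}" for X Y
    using that c spread_disjoint by metis
  then have "proper_colouring (grassmann_graph_2 scale) 7 c"
    using c(1) by (simp add: proper_colouring_def pverts_grassmann_bit parcs_grassmann_bit Pi_iff)
  then show thesis
    by (rule that)
qed

lemma pencil_bounds: "\<Union>pencil \<subseteq> {..<16}"
  using xor_line_subset[of 1] by (auto simp: pencil_def)

text \<open>All these lines contain the nonzero vector \<open>p 1\<close>, so any two of them meet
  in more than 0.\<close>

lemma pencil_clique: "clique_set (grassmann_graph_2 scale) (image p ` pencil)"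
proof -
  have "X \<in> lines \<and> p 1 \<in> X" if X: "X \<in> image p ` pencil" for X
  proof -
    obtain b where "b \<in> set [2, 4, 6, 8, 10, 12, 14]" "X = p ` xor_line (1, b)"
      using X unfolding pencil_def by blast
    moreover from this have "b \<noteq> 0" "1 \<noteq> b" "b < 16"
      by auto
    ultimately show ?thesis
      using image_xor_line_in_lines[of 1 b] by (auto simp: xor_line_def)
  qed
  moreover have "p 1 \<noteq> 0"
    by (simp add: p_eq_0_iff)
  ultimately show ?thesis
    unfolding clique_set_def pverts_grassmann_bit parcs_grassmann_bit by auto
qed

lemma spread_independent:
  "i < 7 \<Longrightarrow> independent_set (grassmann_graph_2 scale) (spread i)"
  unfolding independent_set_def pverts_grassmann_bit parcs_grassmann_bit
  using spread_lines spread_disjoint by fastforce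

lemma card_spread_0: "card (spread 0) = 5"
proof -
  have hd: "hd packing = packing ! 0"
    by (rule hd_conv_nth) (simp add: packing_def)
  have "packing ! 0 \<in> set packing"
    using length_packing by simp
  then have "\<Union>(xor_line ` set (packing ! 0)) \<subseteq> {..<16}"
    using packing_line_subset by blast
  then show ?thesis
    using card_image_image card_packing_hd by (simp add: spread_def hd)
qed

lemma independence_number_grassmann: "independence_number (grassmann_graph_2 scale) = 5"
  unfolding independence_number_def
proof (rule Max_eqI)
  \<comment> \<open>With 16 vectors the counting bound reads \<open>3 * card S <= 15\<close>;
    equality holds for \<open>spread 0\<close>.\<close>
  have le: "card S \<le> 5" if "independent_set (grassmann_graph_2 scale) S" for S
    using card_independent_set_le[OF finite_card_UNIV(1) that] finite_card_UNIV(2) by simp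
  then have "{card S | S. independent_set (grassmann_graph_2 scale) S} \<subseteq> {..5}"
    by auto
  then show "finite {card S | S. independent_set (grassmann_graph_2 scale) S}"
    by (rule finite_subset) simp
  show "k \<le> 5" if "k \<in> {card S | S. independent_set (grassmann_graph_2 scale) S}" for k
    using that le by auto
  show "5 \<in> {card S | S. independent_set (grassmann_graph_2 scale) S}"
    using spread_independent[of 0] card_spread_0 by force
qed

lemma not_clique_lines: "\<not> clique_set (grassmann_graph_2 scale) (pverts (grassmann_graph_2 scale))"
proof
  assume clique: "clique_set (grassmann_graph_2 scale) (pverts (grassmann_graph_2 scale))"
  \<comment> \<open>A spread has five members, so it supplies two distinct lines that are not
    adjacent.\<close>
  obtain X Y where XY: "X \<in> spread 0" "Y \<in> spread 0" "X \<noteq> Y"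
    using card_spread_0 card_le_Suc0_iff_eq[of "spread 0"] card_ge_0_finite[of "spread 0"] by auto
  then have "X \<in> lines" "Y \<in> lines" "X \<inter> Y = {0}"
    using spread_lines[of 0] spread_disjoint[of 0] by auto
  then show False
    using clique XY(3) by (auto simp: clique_set_def pverts_grassmann_bit parcs_grassmann_bit)
qed

end

theorem mainTheorem3:
  fixes scale :: "bit \<Rightarrow> 'v::ab_group_add \<Rightarrow> 'v"
    and G :: "'v set pair_pre_digraph"
  assumes "vector_space scale"
    and "vector_space.dim scale (UNIV :: 'v set) = 4"
    and "G = grassmann_graph_2 scale"
  shows "\<not> core_graph G
    \<and> chromatic_number G = 7 \<and> clique_number G = 7
    \<and> independence_number G = 5"
proof -
  interpret binary_vector_space scale
    using assms(1) by (simp add: binary_vector_space_def)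
  obtain p :: "nat \<Rightarrow> 'v" where "bij_betw p {..<2 ^ 4} UNIV" "\<And>m n. p (xor m n) = p m + p n"
    using xor_coordinates_exist[OF assms(2) zero_less_numeral] by metis
  then interpret binary_space_4 scale p
    by unfold_locales simp_all
  \<comment> \<open>The clique has exactly as many vertices as the packing has spreads, so colouring
    and clique meet the sandwich lemmas at 7.\<close>
  define C where "C = image p ` pencil"
  have card_C: "card C = 7"
    using card_image_image[OF pencil_bounds] by (simp add: C_def card_pencil)
  have clique: "clique_set G C"
    using pencil_clique by (simp add: C_def assms(3))
  obtain c where colouring: "proper_colouring G (card C) c"
    using spread_colouring by (auto simp: card_C assms(3))
  have "\<not> core_graph G"
    using not_core_graph_if_colouring_by_clique[OF colouring clique] not_clique_lines card_C
      card_ge_0_finite[of C] by (simp add: assms(3))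
  moreover have "chromatic_number G = 7" "clique_number G = 7"
    using chromatic_number_eq_card_clique[OF colouring clique]
      clique_number_eq_colours[OF colouring clique] by (simp_all add: card_C)
  ultimately show ?thesis
    using independence_number_grassmann by (simp add: assms(3))
qed

end
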